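(* Let $f:\mathcal{C}(1)\to\mathcal{C}(2)$ be a morphism of regular exact couples of $R$-modules (with bidegrees $\mathbf{a},\mathbf{b},\mathbf{c}$, and $\sigma=\det[\mathbf{a}\ (\mathbf{b}+\mathbf{c})]$) such that for a given $n\in\mathbb{Z}$ the following hold: (i) For $s=1,2$ the filtration diagram of $L_n(s)$ is constant; i.e. $F_{\mathbf{x}(n)+r\mathbf{a}}(s)=L_n(s)$ for all $r\in\mathbb{Z}$. (ii) For all $\mathbf{x}$ with $\det[\mathbf{a}\ \mathbf{x}]=n$, the induced map $f^\infty:E^\infty_{\mathbf{x}+\mathbf{b}}(1)\to E^\infty_{\mathbf{x}+\mathbf{b}}(2)$ is a monomorphism. (iii) $L_{n+\sigma}f$ restricts to a monomorphism $\operatorname{im}(L^{n+\sigma}(1)\to L_{n+\sigma}(1))\to\operatorname{im}(L^{n+\sigma}(2)\to L_{n+\sigma}(2))$. Then $f$ induces a monomorphism $L^{n+\sigma}f:L^{n+\sigma}(1)\to L^{n+\sigma}(2)$.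
   Context: $R$ is a unital ring. A $(\mathbb{Z}\times\mathbb{Z})$-bigraded exact couple $(E,D,i,j,k)$ with bidegrees $\mathbf{a},\mathbf{b},\mathbf{c}\in\mathbb{Z}\times\mathbb{Z}$ consists of families of $R$-modules $D_{\mathbf{x}},E_{\mathbf{x}}$ ($\mathbf{x}\in\mathbb{Z}\times\mathbb{Z}$) and $R$-linear maps $i_{\mathbf{x}}:D_{\mathbf{x}}\to D_{\mathbf{x}+\mathbf{a}}$, $j_{\mathbf{x}}:D_{\mathbf{x}}\to E_{\mathbf{x}+\mathbf{b}}$, $k_{\mathbf{x}}:E_{\mathbf{x}}\to D_{\mathbf{x}+\mathbf{c}}$ such that $D_{\mathbf{x}-\mathbf{a}}\xrightarrow{i}D_{\mathbf{x}}\xrightarrow{j}E_{\mathbf{x}+\mathbf{b}}\xrightarrow{k}D_{\mathbf{x}+\mathbf{b}+\mathbf{c}}\xrightarrow{i}D_{\mathbf{x}+\mathbf{a}+\mathbf{b}+\mathbf{c}}$ is exact for all $\mathbf{x}$. It is regular if $\sigma:=\det[\mathbf{a}\ (\mathbf{b}+\mathbf{c})]\in\{1,-1\}$. A morphism of exact couples with equal bidegrees is a pair of families $D_{\mathbf{x}}(1)\to D_{\mathbf{x}}(2)$, $E_{\mathbf{x}}(1)\to E_{\mathbf{x}}(2)$ of $R$-linear maps commuting with $i,j,k$. With $i^r_{\mathbf{x}}:D_{\mathbf{x}}\to D_{\mathbf{x}+r\mathbf{a}}$ the $r$-fold composite of $i$: $Z^r_{\mathbf{x}+\mathbf{b}}=k^{-1}(\operatorname{im}\,i^r_{\mathbf{x}+\mathbf{b}+\mathbf{c}-r\mathbf{a}})$,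 $B^r_{\mathbf{x}+\mathbf{b}}=j(\ker i^r_{\mathbf{x}})$, $E^\infty_{\mathbf{x}+\mathbf{b}}=\bigcap_rZ^r_{\mathbf{x}+\mathbf{b}}/\bigcup_rB^r_{\mathbf{x}+\mathbf{b}}$. Put $\mathbf{x}(m)=\sigma m(\mathbf{b}+\mathbf{c})$ for $m\in\mathbb{Z}$; then $\det[\mathbf{a}\ \mathbf{x}]=m$ iff $\mathbf{x}=\mathbf{x}(m)+r\mathbf{a}$ for some $r\in\mathbb{Z}$. Let $D(m)$ be the diagram $r\mapsto D_{\mathbf{x}(m)+r\mathbf{a}}$ ($r\in\mathbb{Z}$, structure maps $i$). Then $L_m:=\operatorname{colim}D(m)$, filtered by $F_{\mathbf{x}}=\operatorname{im}(D_{\mathbf{x}}\to L_m)$, and $L^m:=\lim D(m)$. The map $L^m\to L_m$ is the composite $L^m\to D_{\mathbf{x}}\to L_m$ for any $\mathbf{x}$ with $\det[\mathbf{a}\ \mathbf{x}]=m$. Morphisms of exact couples induce maps on all these objects. *)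

theory Defs
  imports "HOL-Algebra.Module" "HOL-Algebra.AbelCoset" "HOL-Library.Product_Plus"
begin

section \<open>Modules over a not necessarily commutative ring\<close>

text \<open>The library locale \<open>module\<close> insists on a commutative ring of scalars; the following
  is the same notion for an arbitrary unital ring. As for \<open>module\<close>, the multiplicative fields of
  the record \<open>M\<close> play no role.\<close>

locale left_module = R?: ring R + M?: abelian_group M
  for R :: "('r, 'm) ring_scheme" (structure) and M :: "('r, 'a, 'n) module_scheme" (structure) +
  assumes smult_closed [simp, intro]:
      "\<lbrakk>r \<in> carrier R; x \<in> carrier M\<rbrakk> \<Longrightarrow> r \<odot>\<^bsub>M\<^esub> x \<in> carrier M"
    and smult_l_distr:
      "\<lbrakk>r \<in> carrier R; s \<in> carrier R; x \<in> carrier M\<rbrakk> \<Longrightarrow>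
        (r \<oplus>\<^bsub>R\<^esub> s) \<odot>\<^bsub>M\<^esub> x = r \<odot>\<^bsub>M\<^esub> x \<oplus>\<^bsub>M\<^esub> s \<odot>\<^bsub>M\<^esub> x"
    and smult_r_distr:
      "\<lbrakk>r \<in> carrier R; x \<in> carrier M; y \<in> carrier M\<rbrakk> \<Longrightarrow>
        r \<odot>\<^bsub>M\<^esub> (x \<oplus>\<^bsub>M\<^esub> y) = r \<odot>\<^bsub>M\<^esub> x \<oplus>\<^bsub>M\<^esub> r \<odot>\<^bsub>M\<^esub> y"
    and smult_assoc1:
      "\<lbrakk>r \<in> carrier R; s \<in> carrier R; x \<in> carrier M\<rbrakk> \<Longrightarrow>
        (r \<otimes>\<^bsub>R\<^esub> s) \<odot>\<^bsub>M\<^esub> x = r \<odot>\<^bsub>M\<^esub> (s \<odot>\<^bsub>M\<^esub> x)"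
    and smult_one [simp]:
      "x \<in> carrier M \<Longrightarrow> \<one>\<^bsub>R\<^esub> \<odot>\<^bsub>M\<^esub> x = x"

definition mod_hom ::
  "('r, 'm) ring_scheme \<Rightarrow> ('r, 'a, 'n) module_scheme \<Rightarrow> ('r, 'b, 'k) module_scheme \<Rightarrow> ('a \<Rightarrow> 'b) set"
  where "mod_hom R M N =
    {h \<in> hom (add_monoid M) (add_monoid N).
      \<forall>r\<in>carrier R. \<forall>x\<in>carrier M. h (r \<odot>\<^bsub>M\<^esub> x) = r \<odot>\<^bsub>N\<^esub> h x}"

definition mod_mono ::
  "('r, 'm) ring_scheme \<Rightarrow> ('r, 'a, 'n) module_scheme \<Rightarrow> ('r, 'b, 'k) module_scheme \<Rightarrow> ('a \<Rightarrow> 'b) \<Rightarrow> bool"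
  where "mod_mono R M N h \<longleftrightarrow> h \<in> mod_hom R M N \<and> inj_on h (carrier M)"

text \<open>The quotient \<open>Z/B\<close> of submodules \<open>B \<subseteq> Z\<close> of \<open>M\<close>, with cosets as elements.\<close>

definition subquot :: "('r, 'a, 'n) module_scheme \<Rightarrow> 'a set \<Rightarrow> 'a set \<Rightarrow> ('r, 'a set) module"
  where "subquot M Z B =
    \<lparr>carrier = (\<lambda>z. B +>\<^bsub>M\<^esub> z) ` Z, mult = undefined, one = undefined,
     zero = B, add = (\<lambda>X Y. X <+>\<^bsub>M\<^esub> Y), smult = (\<lambda>r X. \<Union>x\<in>X. B +>\<^bsub>M\<^esub> (r \<odot>\<^bsub>M\<^esub> x))\<rparr>"

text \<open>The map of quotients induced by \<open>h\<close>, sending the coset of \<open>z\<close> to the coset of \<open>h z\<close>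
  with respect to \<open>B'\<close> in \<open>N\<close>.\<close>

definition subquot_map ::
  "('r, 'b, 'n) module_scheme \<Rightarrow> 'b set \<Rightarrow> ('a \<Rightarrow> 'b) \<Rightarrow> 'a set \<Rightarrow> 'b set"
  where "subquot_map N B' h X = (\<Union>x\<in>X. B' +>\<^bsub>N\<^esub> h x)"


section \<open>Diagrams of modules indexed by the ordered set of integers\<close>

record ('r, 'a) zdiagram =
  obj :: "int \<Rightarrow> ('r, 'a) module"
  arr :: "int \<Rightarrow> 'a \<Rightarrow> 'a"  \<comment> \<open>\<open>arr A r\<close> maps \<open>obj A r\<close> to \<open>obj A (r + 1)\<close>\<close>

primrec arr_pow :: "('r, 'a) zdiagram \<Rightarrow> int \<Rightarrow> nat \<Rightarrow> 'a \<Rightarrow> 'a" where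
  "arr_pow A r 0 = (\<lambda>d. d)"
| "arr_pow A r (Suc p) = (\<lambda>d. arr A (r + int p) (arr_pow A r p d))"

text \<open>The limit is the module of compatible families. The colimit is the usual directed colimit:
  the quotient of the disjoint union of the objects that identifies \<open>d\<close> in degree \<open>r\<close> with \<open>e\<close> in
  degree \<open>s\<close> when they become equal in some degree \<open>r + p = s + q\<close>.\<close>

definition zlim :: "('r, 'a) zdiagram \<Rightarrow> ('r, int \<Rightarrow> 'a) module" where
  "zlim A =
    \<lparr>carrier = {u. \<forall>r. u r \<in> carrier (obj A r) \<and> arr A r (u r) = u (r + 1)},
     mult = undefined, one = undefined,
     zero = (\<lambda>r. \<zero>\<^bsub>obj A r\<^esub>), add = (\<lambda>u v r. u r \<oplus>\<^bsub>obj A r\<^esub> v r),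
     smult = (\<lambda>\<alpha> u r. \<alpha> \<odot>\<^bsub>obj A r\<^esub> u r)\<rparr>"

definition zcolim_in :: "('r, 'a) zdiagram \<Rightarrow> int \<Rightarrow> 'a \<Rightarrow> (int \<times> 'a) set" where
  "zcolim_in A r d =
    {(s, e). e \<in> carrier (obj A s) \<and>
      (\<exists>p q. r + int p = s + int q \<and> arr_pow A r p d = arr_pow A s q e)}"

definition zcolim :: "('r, 'a) zdiagram \<Rightarrow> ('r, (int \<times> 'a) set) module" where
  "zcolim A =
    \<lparr>carrier = (\<Union>r. zcolim_in A r ` carrier (obj A r)),
     mult = undefined, one = undefined,
     zero = zcolim_in A 0 \<zero>\<^bsub>obj A 0\<^esub>,
     add = (\<lambda>X Y. \<Union>{zcolim_in A r (d \<oplus>\<^bsub>obj A r\<^esub> e) | r d e. (r, d) \<in> X \<and> (r, e) \<in> Y}),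
     smult = (\<lambda>\<alpha> X. \<Union>(r, d)\<in>X. zcolim_in A r (\<alpha> \<odot>\<^bsub>obj A r\<^esub> d))\<rparr>"

definition zlim_map :: "(int \<Rightarrow> 'a \<Rightarrow> 'b) \<Rightarrow> (int \<Rightarrow> 'a) \<Rightarrow> (int \<Rightarrow> 'b)" where
  "zlim_map \<phi> u = (\<lambda>r. \<phi> r (u r))"

definition zcolim_map ::
  "('r, 'b) zdiagram \<Rightarrow> (int \<Rightarrow> 'a \<Rightarrow> 'b) \<Rightarrow> (int \<times> 'a) set \<Rightarrow> (int \<times> 'b) set" where
  "zcolim_map A' \<phi> X = (\<Union>(r, d)\<in>X. zcolim_in A' r (\<phi> r d))"

text \<open>The map from the limit to the colimit through the object of degree 0; any other degree
  gives the same map on \<open>zlim A\<close>.\<close>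

definition zlim_to_zcolim :: "('r, 'a) zdiagram \<Rightarrow> (int \<Rightarrow> 'a) \<Rightarrow> (int \<times> 'a) set" where
  "zlim_to_zcolim A u = zcolim_in A 0 (u 0)"

definition zcanon_image :: "('r, 'a) zdiagram \<Rightarrow> ('r, (int \<times> 'a) set) module" where
  "zcanon_image A = (zcolim A)\<lparr>carrier := zlim_to_zcolim A ` carrier (zlim A)\<rparr>"


section \<open>Bigraded exact couples\<close>

definition det2 :: "int \<times> int \<Rightarrow> int \<times> int \<Rightarrow> int" where
  "det2 x y = fst x * snd y - fst y * snd x"

definition zscale :: "int \<Rightarrow> int \<times> int \<Rightarrow> int \<times> int" (infixr \<open>*\<^sub>Z\<close> 75) where
  "m *\<^sub>Z x = (m * fst x, m * snd x)"

record ('r, 'd, 'e) couple =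
  Dmod :: "int \<times> int \<Rightarrow> ('r, 'd) module"
  Emod :: "int \<times> int \<Rightarrow> ('r, 'e) module"
  imap :: "int \<times> int \<Rightarrow> 'd \<Rightarrow> 'd"
  jmap :: "int \<times> int \<Rightarrow> 'd \<Rightarrow> 'e"
  kmap :: "int \<times> int \<Rightarrow> 'e \<Rightarrow> 'd"

locale exact_couple = ring R
  for R :: "('r, 'm) ring_scheme" (structure)
    and a b c :: "int \<times> int" and C :: "('r, 'd, 'e) couple" +
  assumes D_module: "left_module R (Dmod C x)"
    and E_module: "left_module R (Emod C x)"
    and i_hom: "imap C x \<in> mod_hom R (Dmod C x) (Dmod C (x + a))"
    and j_hom: "jmap C x \<in> mod_hom R (Dmod C x) (Emod C (x + b))"
    and k_hom: "kmap C x \<in> mod_hom R (Emod C x) (Dmod C (x + c))"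
    and exact_ij:
      "imap C (x - a) ` carrier (Dmod C (x - a)) = a_kernel (Dmod C x) (Emod C (x + b)) (jmap C x)"
    and exact_jk:
      "jmap C x ` carrier (Dmod C x) = a_kernel (Emod C (x + b)) (Dmod C (x + b + c)) (kmap C (x + b))"
    and exact_ki:
      "kmap C (x + b) ` carrier (Emod C (x + b)) =
        a_kernel (Dmod C (x + b + c)) (Dmod C (x + a + b + c)) (imap C (x + b + c))"

definition sigma :: "int \<times> int \<Rightarrow> int \<times> int \<Rightarrow> int \<times> int \<Rightarrow> int" where
  "sigma a b c = det2 a (b + c)"

locale regular_exact_couple = exact_couple +
  assumes regular: "sigma a b c \<in> {1, -1}"

locale couple_morphism =
  C1: exact_couple R a b c C1 + C2: exact_couple R a b c C2
  for R :: "('r, 'm) ring_scheme" (structure)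
    and a b c :: "int \<times> int"
    and C1 :: "('r, 'd1, 'e1) couple" and C2 :: "('r, 'd2, 'e2) couple"
    and fD :: "int \<times> int \<Rightarrow> 'd1 \<Rightarrow> 'd2" and fE :: "int \<times> int \<Rightarrow> 'e1 \<Rightarrow> 'e2" +
  assumes fD_hom: "fD x \<in> mod_hom R (Dmod C1 x) (Dmod C2 x)"
    and fE_hom: "fE x \<in> mod_hom R (Emod C1 x) (Emod C2 x)"
    and f_i: "d \<in> carrier (Dmod C1 x) \<Longrightarrow> fD (x + a) (imap C1 x d) = imap C2 x (fD x d)"
    and f_j: "d \<in> carrier (Dmod C1 x) \<Longrightarrow> fE (x + b) (jmap C1 x d) = jmap C2 x (fD x d)"
    and f_k: "e \<in> carrier (Emod C1 x) \<Longrightarrow> fD (x + c) (kmap C1 x e) = kmap C2 x (fE x e)"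


section \<open>The limit page\<close>

primrec i_pow :: "int \<times> int \<Rightarrow> ('r, 'd, 'e) couple \<Rightarrow> nat \<Rightarrow> int \<times> int \<Rightarrow> 'd \<Rightarrow> 'd" where
  "i_pow a C 0 x = (\<lambda>d. d)"
| "i_pow a C (Suc r) x = (\<lambda>d. imap C (x + int r *\<^sub>Z a) (i_pow a C r x d))"

text \<open>The following are indexed by the position \<open>y = x + b\<close> in the \<open>E\<close>-family.\<close>

definition Zcyc ::
  "int \<times> int \<Rightarrow> int \<times> int \<Rightarrow> ('r, 'd, 'e) couple \<Rightarrow> nat \<Rightarrow> int \<times> int \<Rightarrow> 'e set" where
  "Zcyc a c C r y =
    {e \<in> carrier (Emod C y).
      kmap C y e \<in> i_pow a C r (y + c - int r *\<^sub>Z a) ` carrier (Dmod C (y + c - int r *\<^sub>Z a))}"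

definition Bbdy ::
  "int \<times> int \<Rightarrow> int \<times> int \<Rightarrow> ('r, 'd, 'e) couple \<Rightarrow> nat \<Rightarrow> int \<times> int \<Rightarrow> 'e set" where
  "Bbdy a b C r y =
    jmap C (y - b) ` a_kernel (Dmod C (y - b)) (Dmod C (y - b + int r *\<^sub>Z a)) (i_pow a C r (y - b))"

definition E_inf ::
  "int \<times> int \<Rightarrow> int \<times> int \<Rightarrow> int \<times> int \<Rightarrow> ('r, 'd, 'e) couple \<Rightarrow> int \<times> int \<Rightarrow> ('r, 'e set) module" where
  "E_inf a b c C y = subquot (Emod C y) (\<Inter>r. Zcyc a c C r y) (\<Union>r. Bbdy a b C r y)"

definition E_inf_map ::
  "int \<times> int \<Rightarrow> int \<times> int \<Rightarrow> ('r, 'd2, 'e2) couple \<Rightarrow> (int \<times> int \<Rightarrow> 'e1 \<Rightarrow> 'e2) \<Rightarrow>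
    int \<times> int \<Rightarrow> 'e1 set \<Rightarrow> 'e2 set" where
  "E_inf_map a b C2 fE y = subquot_map (Emod C2 y) (\<Union>r. Bbdy a b C2 r y) (fE y)"


section \<open>The universal abutment objects\<close>

definition xpos :: "int \<times> int \<Rightarrow> int \<times> int \<Rightarrow> int \<times> int \<Rightarrow> int \<Rightarrow> int \<Rightarrow> int \<times> int" where
  "xpos a b c m r = (sigma a b c * m) *\<^sub>Z (b + c) + r *\<^sub>Z a"

definition Ddiag ::
  "int \<times> int \<Rightarrow> int \<times> int \<Rightarrow> int \<times> int \<Rightarrow> ('r, 'd, 'e) couple \<Rightarrow> int \<Rightarrow> ('r, 'd) zdiagram" where
  "Ddiag a b c C m =
    \<lparr>obj = (\<lambda>r. Dmod C (xpos a b c m r)), arr = (\<lambda>r. imap C (xpos a b c m r))\<rparr>"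

definition L_colim ::
  "int \<times> int \<Rightarrow> int \<times> int \<Rightarrow> int \<times> int \<Rightarrow> ('r, 'd, 'e) couple \<Rightarrow> int \<Rightarrow> ('r, (int \<times> 'd) set) module" where
  "L_colim a b c C m = zcolim (Ddiag a b c C m)"

definition L_lim ::
  "int \<times> int \<Rightarrow> int \<times> int \<Rightarrow> int \<times> int \<Rightarrow> ('r, 'd, 'e) couple \<Rightarrow> int \<Rightarrow> ('r, int \<Rightarrow> 'd) module" where
  "L_lim a b c C m = zlim (Ddiag a b c C m)"

text \<open>\<open>F_filt a b c C m r\<close> is the filtration stage of \<open>L_colim a b c C m\<close> at the position
  \<open>xpos a b c m r\<close>.\<close>

definition F_filt ::
  "int \<times> int \<Rightarrow> int \<times> int \<Rightarrow> int \<times> int \<Rightarrow> ('r, 'd, 'e) couple \<Rightarrow> int \<Rightarrow> int \<Rightarrow> (int \<times> 'd) set set" where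
  "F_filt a b c C m r =
    zcolim_in (Ddiag a b c C m) r ` carrier (Dmod C (xpos a b c m r))"

definition L_image ::
  "int \<times> int \<Rightarrow> int \<times> int \<Rightarrow> int \<times> int \<Rightarrow> ('r, 'd, 'e) couple \<Rightarrow> int \<Rightarrow> ('r, (int \<times> 'd) set) module" where
  "L_image a b c C m = zcanon_image (Ddiag a b c C m)"

definition L_colim_map ::
  "int \<times> int \<Rightarrow> int \<times> int \<Rightarrow> int \<times> int \<Rightarrow> ('r, 'd2, 'e2) couple \<Rightarrow> (int \<times> int \<Rightarrow> 'd1 \<Rightarrow> 'd2) \<Rightarrow> int \<Rightarrow>
    (int \<times> 'd1) set \<Rightarrow> (int \<times> 'd2) set" where
  "L_colim_map a b c C2 fD m = zcolim_map (Ddiag a b c C2 m) (\<lambda>r. fD (xpos a b c m r))"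

definition L_lim_map ::
  "int \<times> int \<Rightarrow> int \<times> int \<Rightarrow> int \<times> int \<Rightarrow> (int \<times> int \<Rightarrow> 'd1 \<Rightarrow> 'd2) \<Rightarrow> int \<Rightarrow>
    (int \<Rightarrow> 'd1) \<Rightarrow> (int \<Rightarrow> 'd2)" where
  "L_lim_map a b c fD m = zlim_map (\<lambda>r. fD (xpos a b c m r))"

end

theory Submission
  imports Defs
begin

text \<open>Let \<open>u\<close> and \<open>v\<close> be compatible families in the limit over the line
  \<open>det = n + \<sigma>\<close> with the same image in the second couple. Their images in the colimit then
  have the same image as well, so the monomorphism on the images of the limits makes the classes of
  \<open>u\<close> and \<open>v\<close> in the colimit equal, which means that \<open>u\<close> and \<open>v\<close> agree in
  some degree \<open>p\<close>, and hence in all degrees above it.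

  It remains to descend: if \<open>u\<close> and \<open>v\<close> agree in degree \<open>s + 1\<close>, they agree in
  degree \<open>s\<close>. The difference \<open>d = u s - v s\<close> is killed by \<open>i\<close> and by \<open>f\<close>,
  and lies in the image of every power of \<open>i\<close>, since \<open>u - v\<close> continues indefinitely
  downwards. By exactness \<open>d = k e\<close>, and the second property of \<open>d\<close> says that \<open>e\<close> is
  a permanent cycle. Now \<open>k (f e) = f d = 0\<close>, so \<open>f e = j g\<close> with \<open>g\<close> on the line
  \<open>det = n\<close> of the second couple. There the filtration of the colimit is constant, so the class
  of \<open>g\<close> comes from one step further back: some power of \<open>i\<close> kills \<open>g - i g'\<close>.
  As \<open>j i = 0\<close>, also \<open>f e = j (g - i g')\<close>, an infinite boundary. The monomorphism on the
  limit page makes \<open>e\<close> an infinite boundary, so \<open>e\<close> is in the image of \<open>j\<close> and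
  \<open>d = k e = 0\<close>.

  This descent is the lemma \<open>stable_kernel_trivial\<close>; the lemma \<open>F_filt_constantD\<close>
  extracts \<open>g'\<close> from the filtration, and \<open>mem_B_inf_if_mono\<close> reads the monomorphism of
  limit pages at the level of elements.\<close>

section \<open>Homomorphisms of modules\<close>

lemma (in abelian_group) a_minus_eq_zero_iff:
  assumes "x \<in> carrier G" "y \<in> carrier G"
  shows "x \<ominus> y = \<zero> \<longleftrightarrow> x = y"
proof
  assume "x \<ominus> y = \<zero>"
  then have "\<ominus> (\<ominus> y) = x" using assms by (intro minus_equality) (simp_all add: a_minus_def)
  then show "x = y" using assms by simp
qed (use assms in \<open>simp add: a_minus_def r_neg\<close>)

lemma left_module_abelian_group: "left_module R M \<Longrightarrow> abelian_group M"
  by (simp add: left_module_def)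

lemma mem_a_kernel_iff: "x \<in> a_kernel M N h \<longleftrightarrow> x \<in> carrier M \<and> h x = \<zero>\<^bsub>N\<^esub>"
  by (simp add: a_kernel_def kernel_def)

lemma mod_hom_closed: "h \<in> mod_hom R M N \<Longrightarrow> x \<in> carrier M \<Longrightarrow> h x \<in> carrier N"
  by (auto simp: mod_hom_def hom_def)

lemma mod_hom_add:
  "h \<in> mod_hom R M N \<Longrightarrow> x \<in> carrier M \<Longrightarrow> y \<in> carrier M \<Longrightarrow> h (x \<oplus>\<^bsub>M\<^esub> y) = h x \<oplus>\<^bsub>N\<^esub> h y"
  by (auto simp: mod_hom_def hom_def)

lemma mod_hom_smult:
  "h \<in> mod_hom R M N \<Longrightarrow> \<alpha> \<in> carrier R \<Longrightarrow> x \<in> carrier M \<Longrightarrow> h (\<alpha> \<odot>\<^bsub>M\<^esub> x) = \<alpha> \<odot>\<^bsub>N\<^esub> h x"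
  by (auto simp: mod_hom_def)

lemma mod_hom_group_hom:
  assumes "abelian_group M" "abelian_group N" "h \<in> mod_hom R M N"
  shows "group_hom (add_monoid M) (add_monoid N) h"
  using assms
  by (auto simp: group_hom_def group_hom_axioms_def mod_hom_def intro: abelian_group.a_group)

lemma mod_hom_zero:
  assumes "abelian_group M" "abelian_group N" "h \<in> mod_hom R M N"
  shows "h \<zero>\<^bsub>M\<^esub> = \<zero>\<^bsub>N\<^esub>"
  using group_hom.hom_one[OF mod_hom_group_hom[OF assms]] by simp

lemma mod_hom_uminus:
  assumes "abelian_group M" "abelian_group N" "h \<in> mod_hom R M N" "x \<in> carrier M"
  shows "h (\<ominus>\<^bsub>M\<^esub> x) = \<ominus>\<^bsub>N\<^esub> h x"
  using group_hom.hom_inv[OF mod_hom_group_hom[OF assms(1-3)]] assms(4) by (simp add: a_inv_def)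

lemma mod_hom_minus:
  assumes "abelian_group M" "abelian_group N" "h \<in> mod_hom R M N" "x \<in> carrier M" "y \<in> carrier M"
  shows "h (x \<ominus>\<^bsub>M\<^esub> y) = h x \<ominus>\<^bsub>N\<^esub> h y"
  using assms
  by (simp add: a_minus_def mod_hom_add mod_hom_uminus abelian_group.a_inv_closed)

lemma mod_hom_comp:
  assumes "g \<in> mod_hom R M N" "h \<in> mod_hom R N P"
  shows "(\<lambda>x. h (g x)) \<in> mod_hom R M P"
  using assms by (auto simp: mod_hom_def hom_def Pi_iff)

lemma mod_hom_id: "(\<lambda>x. x) \<in> mod_hom R M M"
  by (auto simp: mod_hom_def hom_def)


section \<open>Colimits of diagrams indexed by the integers\<close>

lemma arr_pow_add: "arr_pow A r (p + q) d = arr_pow A (r + int p) q (arr_pow A r p d)"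
  by (induction q) (simp_all add: algebra_simps)

text \<open>Becoming equal in a later degree is an equivalence relation because the indexing order is
  directed; hence a class of the colimit does not depend on its representative.\<close>

lemma zcolim_in_eqI:
  assumes "r + int p = s + int q" and "arr_pow A r p d = arr_pow A s q e"
  shows "zcolim_in A r d = zcolim_in A s e"
proof -
  have sub: "zcolim_in A r d \<subseteq> zcolim_in A s e"
    if pos: "r + int p = s + int q" and eq: "arr_pow A r p d = arr_pow A s q e" for r p d s q e
  proof
    fix z assume z: "z \<in> zcolim_in A r d"
    then obtain t g where zg: "z = (t, g)" by (cases z)
    from z zg obtain p' q' where g: "g \<in> carrier (obj A t)" "r + int p' = t + int q'"
      "arr_pow A r p' d = arr_pow A t q' g"
      by (auto simp: zcolim_in_def)
    have "arr_pow A s (q + p') e = arr_pow A (r + int p) p' (arr_pow A r p d)"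
      using pos eq by (simp add: arr_pow_add)
    also have "\<dots> = arr_pow A r (p' + p) d" by (simp add: arr_pow_add[symmetric] add.commute)
    also have "\<dots> = arr_pow A t (q' + p) g" using g by (simp add: arr_pow_add)
    finally have "arr_pow A s (q + p') e = arr_pow A t (q' + p) g" .
    moreover have "s + int (q + p') = t + int (q' + p)" using g(2) pos by simp
    ultimately show "z \<in> zcolim_in A s e" using g(1) zg unfolding zcolim_in_def by blast
  qed
  show ?thesis using sub[OF assms] sub[OF assms(1)[symmetric] assms(2)[symmetric]] by blast
qed

lemma zcolim_in_eqD:
  assumes "zcolim_in A r d = zcolim_in A s e" and "e \<in> carrier (obj A s)"
  shows "\<exists>p q. r + int p = s + int q \<and> arr_pow A r p d = arr_pow A s q e"
proof -
  have "(s, e) \<in> zcolim_in A s e" using assms(2) by (auto simp: zcolim_in_def)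
  then have "(s, e) \<in> zcolim_in A r d" by (simp only: assms(1))
  then show ?thesis by (simp add: zcolim_in_def)
qed

text \<open>The induced map of colimits is defined as a union over all representatives of a class; by
  naturality they all contribute the same class, so one representative computes it.\<close>

lemma zcolim_map_zcolim_in:
  assumes closed: "\<And>r d. d \<in> carrier (obj A r) \<Longrightarrow> arr A r d \<in> carrier (obj A (r + 1))"
    and natural: "\<And>r d. d \<in> carrier (obj A r) \<Longrightarrow> \<phi> (r + 1) (arr A r d) = arr A' r (\<phi> r d)"
    and d: "d \<in> carrier (obj A r)"
  shows "zcolim_map A' \<phi> (zcolim_in A r d) = zcolim_in A' r (\<phi> r d)"
proof -
  have pow: "arr_pow A t p g \<in> carrier (obj A (t + int p)) \<and>
      \<phi> (t + int p) (arr_pow A t p g) = arr_pow A' t p (\<phi> t g)"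
    if "g \<in> carrier (obj A t)" for t p g
  proof (induction p)
    case (Suc p)
    have "t + int (Suc p) = t + int p + 1" by simp
    then show ?case using Suc closed natural by (simp only: arr_pow.simps)
  qed (use that in simp)
  have "zcolim_in A' s (\<phi> s e) = zcolim_in A' r (\<phi> r d)" if se: "(s, e) \<in> zcolim_in A r d" for s e
  proof -
    obtain p q where e: "e \<in> carrier (obj A s)" "r + int p = s + int q"
      "arr_pow A r p d = arr_pow A s q e"
      using se by (auto simp: zcolim_in_def)
    have "arr_pow A' r p (\<phi> r d) = arr_pow A' s q (\<phi> s e)" using pow[OF d, of p] pow[OF e(1), of q] e by metis
    then show ?thesis using e(2) by (intro zcolim_in_eqI[symmetric])
  qed
  moreover have "(r, d) \<in> zcolim_in A r d" using d by (auto simp: zcolim_in_def)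
  ultimately show ?thesis unfolding zcolim_map_def by blast
qed

lemma arr_pow_zlim: "u \<in> carrier (zlim A) \<Longrightarrow> arr_pow A r p (u r) = u (r + int p)"
  by (induction p) (simp_all add: zlim_def algebra_simps)


section \<open>Iterating the endomorphism of an exact couple\<close>

lemma zscale_simps [simp]:
  "0 *\<^sub>Z x = 0" "1 *\<^sub>Z x = x"
  by (simp_all add: zscale_def zero_prod_def)

lemma zscale_add_left: "(k + l) *\<^sub>Z x = k *\<^sub>Z x + l *\<^sub>Z x"
  by (simp add: zscale_def algebra_simps)

lemma zscale_Suc: "x + int (Suc r) *\<^sub>Z y = x + int r *\<^sub>Z y + y"
  using zscale_add_left[of "int r" 1 y] by (simp add: ac_simps)

context exact_couple
begin

lemma D_group: "abelian_group (Dmod C x)" and E_group: "abelian_group (Emod C x)"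
  by (rule left_module_abelian_group[OF D_module], rule left_module_abelian_group[OF E_module])

lemma i_pow_hom: "i_pow a C r x \<in> mod_hom R (Dmod C x) (Dmod C (x + int r *\<^sub>Z a))"
proof (induction r)
  case (Suc r)
  show ?case unfolding zscale_Suc i_pow.simps by (rule mod_hom_comp[OF Suc i_hom])
qed (simp add: mod_hom_id)

lemma i_pow_eq_zero_mono:
  assumes "i_pow a C r x d = \<zero>\<^bsub>Dmod C (x + int r *\<^sub>Z a)\<^esub>"
  shows "i_pow a C (r + s) x d = \<zero>\<^bsub>Dmod C (x + int (r + s) *\<^sub>Z a)\<^esub>"
proof (induction s)
  case (Suc s)
  show ?case
    unfolding add_Suc_right zscale_Suc i_pow.simps Suc by (rule mod_hom_zero[OF D_group D_group i_hom])
qed (use assms in simp)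

text \<open>Indexing \<open>E\<close> by \<open>x + b\<close>, where \<open>x\<close> is the source of \<open>j\<close>, removes the
  subtraction of \<open>b\<close> from the definition of the boundaries.\<close>

lemma mem_B_inf_iff:
  "e \<in> (\<Union>r. Bbdy a b C r (x + b)) \<longleftrightarrow>
    (\<exists>r d. d \<in> carrier (Dmod C x) \<and> i_pow a C r x d = \<zero>\<^bsub>Dmod C (x + int r *\<^sub>Z a)\<^esub> \<and> e = jmap C x d)"
  unfolding Bbdy_def UN_iff image_iff Bex_def mem_a_kernel_iff by simp

lemma k_j_eq_zero: "d \<in> carrier (Dmod C x) \<Longrightarrow> kmap C (x + b) (jmap C x d) = \<zero>\<^bsub>Dmod C (x + b + c)\<^esub>"
  using exact_jk[of x] by (auto simp: mem_a_kernel_iff)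

lemma j_i_eq_zero:
  "d \<in> carrier (Dmod C (x - a)) \<Longrightarrow> jmap C x (imap C (x - a) d) = \<zero>\<^bsub>Emod C (x + b)\<^esub>"
  using exact_ij[of x] by (auto simp: mem_a_kernel_iff)

text \<open>The boundaries increase with \<open>r\<close>: two elements killed by the powers \<open>r\<close> and
  \<open>r'\<close> of \<open>i\<close> are both killed by the power \<open>r + r'\<close>. So their union is closed under
  addition.\<close>

lemma B_inf_subgroup: "subgroup (\<Union>r. Bbdy a b C r (x + b)) (add_monoid (Emod C (x + b)))"
proof -
  let ?B = "\<Union>r. Bbdy a b C r (x + b)"
  interpret D: abelian_group "Dmod C x" by (rule D_group)
  interpret E: abelian_group "Emod C (x + b)" by (rule E_group)
  note j = j_hom[of x]
  show ?thesis
  proof (rule group.subgroupI[OF E.a_group])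
    show "?B \<subseteq> carrier (add_monoid (Emod C (x + b)))"
    proof
      fix e assume "e \<in> ?B"
      then show "e \<in> carrier (add_monoid (Emod C (x + b)))"
        unfolding mem_B_inf_iff using mod_hom_closed[OF j] by auto
    qed
    have "jmap C x \<zero>\<^bsub>Dmod C x\<^esub> \<in> ?B"
      unfolding mem_B_inf_iff using mod_hom_zero[OF D_group D_group i_pow_hom] by blast
    then show "?B \<noteq> {}" by blast
  next
    fix e assume "e \<in> ?B"
    then obtain r d where d: "d \<in> carrier (Dmod C x)"
      "i_pow a C r x d = \<zero>\<^bsub>Dmod C (x + int r *\<^sub>Z a)\<^esub>" "e = jmap C x d"
      unfolding mem_B_inf_iff by blast
    have "\<ominus>\<^bsub>Emod C (x + b)\<^esub> e = jmap C x (\<ominus>\<^bsub>Dmod C x\<^esub> d)"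
      using d mod_hom_uminus[OF D_group E_group j] by simp
    moreover have "i_pow a C r x (\<ominus>\<^bsub>Dmod C x\<^esub> d) = \<zero>\<^bsub>Dmod C (x + int r *\<^sub>Z a)\<^esub>"
      using mod_hom_uminus[OF D_group D_group i_pow_hom d(1)] d(2)
        monoid.inv_one[OF group.is_monoid[OF abelian_group.a_group[OF D_group]]] by (simp add: a_inv_def)
    ultimately show "inv\<^bsub>add_monoid (Emod C (x + b))\<^esub> e \<in> ?B"
      unfolding mem_B_inf_iff a_inv_def[symmetric] using d(1) by blast
  next
    fix e e' assume "e \<in> ?B" "e' \<in> ?B"
    then obtain r d r' d' where d: "d \<in> carrier (Dmod C x)"
        "i_pow a C r x d = \<zero>\<^bsub>Dmod C (x + int r *\<^sub>Z a)\<^esub>" "e = jmap C x d"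
      and d': "d' \<in> carrier (Dmod C x)"
        "i_pow a C r' x d' = \<zero>\<^bsub>Dmod C (x + int r' *\<^sub>Z a)\<^esub>" "e' = jmap C x d'"
      unfolding mem_B_inf_iff by blast
    have "i_pow a C (r + r') x (d \<oplus>\<^bsub>Dmod C x\<^esub> d') = \<zero>\<^bsub>Dmod C (x + int (r + r') *\<^sub>Z a)\<^esub>"
      using mod_hom_add[OF i_pow_hom d(1) d'(1)] i_pow_eq_zero_mono[OF d(2), of r']
        i_pow_eq_zero_mono[OF d'(2), of r] abelian_monoid.l_zero[OF abelian_group.axioms(1)[OF D_group]]
        abelian_monoid.zero_closed[OF abelian_group.axioms(1)[OF D_group]]
      by (simp add: add.commute)
    moreover have "e \<oplus>\<^bsub>Emod C (x + b)\<^esub> e' = jmap C x (d \<oplus>\<^bsub>Dmod C x\<^esub> d')"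
      using d d' mod_hom_add[OF j] by simp
    ultimately show "e \<otimes>\<^bsub>add_monoid (Emod C (x + b))\<^esub> e' \<in> ?B"
      unfolding mem_B_inf_iff monoid.simps using D.a_closed[OF d(1) d'(1)] by metis
  qed
qed

lemma E_inf_coset_mem_carrier:
  "e \<in> (\<Inter>r. Zcyc a c C r (x + b)) \<Longrightarrow>
    (\<Union>r. Bbdy a b C r (x + b)) +>\<^bsub>Emod C (x + b)\<^esub> e \<in> carrier (E_inf a b c C (x + b))"
  by (simp add: E_inf_def subquot_def)

lemma zero_mem_Z_inf: "\<zero>\<^bsub>Emod C (x + b)\<^esub> \<in> (\<Inter>r. Zcyc a c C r (x + b))"
proof -
  interpret E: abelian_group "Emod C (x + b)" by (rule E_group)
  have "kmap C (x + b) \<zero>\<^bsub>Emod C (x + b)\<^esub>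
      \<in> i_pow a C r (x + b + c - int r *\<^sub>Z a) ` carrier (Dmod C (x + b + c - int r *\<^sub>Z a))" for r
  proof (rule image_eqI[where x = "\<zero>\<^bsub>Dmod C (x + b + c - int r *\<^sub>Z a)\<^esub>"])
    show "kmap C (x + b) \<zero>\<^bsub>Emod C (x + b)\<^esub>
        = i_pow a C r (x + b + c - int r *\<^sub>Z a) \<zero>\<^bsub>Dmod C (x + b + c - int r *\<^sub>Z a)\<^esub>"
      using mod_hom_zero[OF E_group D_group k_hom, of "x + b"]
        mod_hom_zero[OF D_group D_group i_pow_hom, of r "x + b + c - int r *\<^sub>Z a"] by simp
    show "\<zero>\<^bsub>Dmod C (x + b + c - int r *\<^sub>Z a)\<^esub> \<in> carrier (Dmod C (x + b + c - int r *\<^sub>Z a))"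
      using abelian_monoid.zero_closed[OF abelian_group.axioms(1)[OF D_group]] .
  qed
  then show ?thesis by (simp add: Zcyc_def)
qed

end


section \<open>Morphisms of exact couples\<close>

context couple_morphism
begin

lemma f_i_pow: "d \<in> carrier (Dmod C1 x) \<Longrightarrow>
    fD (x + int r *\<^sub>Z a) (i_pow a C1 r x d) = i_pow a C2 r x (fD x d)"
proof (induction r)
  case (Suc r)
  show ?case
    unfolding zscale_Suc i_pow.simps f_i[OF mod_hom_closed[OF C1.i_pow_hom Suc.prems]]
    by (simp only: Suc)
qed simp

lemma fE_B_inf:
  assumes "e \<in> (\<Union>r. Bbdy a b C1 r (x + b))"
  shows "fE (x + b) e \<in> (\<Union>r. Bbdy a b C2 r (x + b))"
proof -
  obtain r d where d: "d \<in> carrier (Dmod C1 x)"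
      "i_pow a C1 r x d = \<zero>\<^bsub>Dmod C1 (x + int r *\<^sub>Z a)\<^esub>" "e = jmap C1 x d"
    using assms unfolding C1.mem_B_inf_iff by blast
  have "i_pow a C2 r x (fD x d) = \<zero>\<^bsub>Dmod C2 (x + int r *\<^sub>Z a)\<^esub>"
    using f_i_pow[OF d(1), of r] d(2) mod_hom_zero[OF C1.D_group C2.D_group fD_hom] by simp
  then show ?thesis
    unfolding C2.mem_B_inf_iff using d f_j mod_hom_closed[OF fD_hom] by blast
qed

text \<open>All of the coset of \<open>e\<close> is mapped into the boundaries as soon as \<open>e\<close> is, because
  \<open>f\<close> preserves boundaries. The right-hand side is the zero of the limit page.\<close>

lemma E_inf_map_eq_zero:
  assumes e: "e \<in> carrier (Emod C1 (x + b))"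
    and fe: "fE (x + b) e \<in> (\<Union>r. Bbdy a b C2 r (x + b))"
  shows "E_inf_map a b C2 fE (x + b) ((\<Union>r. Bbdy a b C1 r (x + b)) +>\<^bsub>Emod C1 (x + b)\<^esub> e)
    = (\<Union>r. Bbdy a b C2 r (x + b))"
proof -
  let ?B1 = "\<Union>r. Bbdy a b C1 r (x + b)" and ?B2 = "\<Union>r. Bbdy a b C2 r (x + b)"
  interpret E1: abelian_group "Emod C1 (x + b)" by (rule C1.E_group)
  interpret E2: abelian_group "Emod C2 (x + b)" by (rule C2.E_group)
  note B1 = C1.B_inf_subgroup[of x] and B2 = C2.B_inf_subgroup[of x]
  have coset: "?B2 +>\<^bsub>Emod C2 (x + b)\<^esub> fE (x + b) z = ?B2"
    if "z \<in> ?B1 +>\<^bsub>Emod C1 (x + b)\<^esub> e" for z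
  proof -
    from that obtain h where h: "h \<in> ?B1" "z = h \<oplus>\<^bsub>Emod C1 (x + b)\<^esub> e"
      unfolding a_r_coset_def' by blast
    have "fE (x + b) z = fE (x + b) h \<oplus>\<^bsub>Emod C2 (x + b)\<^esub> fE (x + b) e"
      using h e subgroup.mem_carrier[OF B1 h(1)] mod_hom_add[OF fE_hom] by simp
    then have fz: "fE (x + b) z \<in> ?B2"
      using subgroup.m_closed[OF B2 fE_B_inf[OF h(1)] fe] by (simp only: monoid.simps)
    show ?thesis
      unfolding a_r_coset_def
      by (rule group.coset_join2[OF E2.a_group subgroup.mem_carrier[OF B2 fz] B2 fz])
  qed
  have "\<zero>\<^bsub>Emod C1 (x + b)\<^esub> \<in> ?B1" using subgroup.one_closed[OF B1] by simp
  then have "?B1 +>\<^bsub>Emod C1 (x + b)\<^esub> e \<noteq> {}" unfolding a_r_coset_def' by blast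
  then show ?thesis
    unfolding E_inf_map_def subquot_map_def using coset by blast
qed

text \<open>The cosets of \<open>e\<close> and of zero have the same image, so injectivity identifies them.\<close>

lemma mem_B_inf_if_mono:
  assumes mono: "mod_mono R (E_inf a b c C1 (x + b)) (E_inf a b c C2 (x + b))
      (E_inf_map a b C2 fE (x + b))"
    and e: "e \<in> (\<Inter>r. Zcyc a c C1 r (x + b))"
    and fe: "fE (x + b) e \<in> (\<Union>r. Bbdy a b C2 r (x + b))"
  shows "e \<in> (\<Union>r. Bbdy a b C1 r (x + b))"
proof -
  let ?B1 = "\<Union>r. Bbdy a b C1 r (x + b)"
  let ?z = "\<zero>\<^bsub>Emod C1 (x + b)\<^esub>"
  interpret E1: abelian_group "Emod C1 (x + b)" by (rule C1.E_group)
  note B1 = C1.B_inf_subgroup[of x]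
  have ec: "e \<in> carrier (Emod C1 (x + b))" using e by (simp add: Zcyc_def)
  have z: "?z \<in> ?B1" using subgroup.one_closed[OF B1] by simp
  have "E_inf_map a b C2 fE (x + b) (?B1 +>\<^bsub>Emod C1 (x + b)\<^esub> e)
      = E_inf_map a b C2 fE (x + b) (?B1 +>\<^bsub>Emod C1 (x + b)\<^esub> ?z)"
    using E_inf_map_eq_zero[OF ec fe] E_inf_map_eq_zero[OF E1.zero_closed fE_B_inf[OF z]] by simp
  then have "?B1 +>\<^bsub>Emod C1 (x + b)\<^esub> e = ?B1 +>\<^bsub>Emod C1 (x + b)\<^esub> ?z"
    using mono C1.E_inf_coset_mem_carrier[OF e] C1.E_inf_coset_mem_carrier[OF C1.zero_mem_Z_inf]
    unfolding mod_mono_def by (blast dest: inj_onD)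
  moreover have "?B1 +>\<^bsub>Emod C1 (x + b)\<^esub> ?z = ?B1"
    using subgroup.subset[OF B1] by (intro E1.a_coset_add_zero) simp
  moreover have "e \<in> ?B1 +>\<^bsub>Emod C1 (x + b)\<^esub> e"
  proof -
    have "e = ?z \<oplus>\<^bsub>Emod C1 (x + b)\<^esub> e" using ec by simp
    with z show ?thesis unfolding a_r_coset_def' by blast
  qed
  ultimately show ?thesis by simp
qed

text \<open>Elements of \<open>ker i\<close> that lie in the image of every power of \<open>i\<close> are the images under
  \<open>k\<close> of permanent cycles, and such an image depends only on the class in the limit page,
  because boundaries are in the image of \<open>j\<close>. The first hypothesis makes the elements of
  \<open>ker k\<close> in the second couple vanish in the limit page: modulo the image of \<open>i\<close>, which
  \<open>j\<close> kills, every element of \<open>D\<close> in degree \<open>x\<close> is annihilated by a power of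
  \<open>i\<close>.\<close>

lemma stable_kernel_trivial:
  assumes const: "\<And>d. d \<in> carrier (Dmod C2 x) \<Longrightarrow>
      \<exists>d'\<in>carrier (Dmod C2 (x - a)). \<exists>q. i_pow a C2 q x d = i_pow a C2 q x (imap C2 (x - a) d')"
    and mono: "mod_mono R (E_inf a b c C1 (x + b)) (E_inf a b c C2 (x + b))
      (E_inf_map a b C2 fE (x + b))"
    and d: "d \<in> carrier (Dmod C1 (x + b + c))"
    and id: "imap C1 (x + b + c) d = \<zero>\<^bsub>Dmod C1 (x + a + b + c)\<^esub>"
    and stable: "\<And>r. d \<in> i_pow a C1 r (x + b + c - int r *\<^sub>Z a) ` carrier (Dmod C1 (x + b + c - int r *\<^sub>Z a))"
    and fd: "fD (x + b + c) d = \<zero>\<^bsub>Dmod C2 (x + b + c)\<^esub>"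
  shows "d = \<zero>\<^bsub>Dmod C1 (x + b + c)\<^esub>"
proof -
  have "d \<in> kmap C1 (x + b) ` carrier (Emod C1 (x + b))"
    unfolding C1.exact_ki mem_a_kernel_iff using d id by simp
  then obtain e where e: "e \<in> carrier (Emod C1 (x + b))" "d = kmap C1 (x + b) e" by blast
  have eZ: "e \<in> (\<Inter>r. Zcyc a c C1 r (x + b))" using e stable by (auto simp: Zcyc_def)
  have "kmap C2 (x + b) (fE (x + b) e) = \<zero>\<^bsub>Dmod C2 (x + b + c)\<^esub>" using f_k[OF e(1)] e(2) fd by simp
  then have "fE (x + b) e \<in> jmap C2 x ` carrier (Dmod C2 x)"
    using mod_hom_closed[OF fE_hom e(1)] unfolding C2.exact_jk mem_a_kernel_iff by blast
  then obtain g where g: "g \<in> carrier (Dmod C2 x)" "fE (x + b) e = jmap C2 x g" by blast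
  obtain g' q where g': "g' \<in> carrier (Dmod C2 (x - a))"
    "i_pow a C2 q x g = i_pow a C2 q x (imap C2 (x - a) g')"
    using const[OF g(1)] by blast
  interpret D: abelian_group "Dmod C2 x" by (rule C2.D_group)
  interpret D': abelian_group "Dmod C2 (x + int q *\<^sub>Z a)" by (rule C2.D_group)
  interpret E: abelian_group "Emod C2 (x + b)" by (rule C2.E_group)
  \<comment> \<open>Correcting \<open>g\<close> by an element of \<open>im i = ker j\<close> leaves \<open>j g\<close> unchanged but moves
    \<open>g\<close> into \<open>ker i^q\<close>.\<close>
  let ?h = "imap C2 (x - a) g'"
  have h: "?h \<in> carrier (Dmod C2 x)" using mod_hom_closed[OF C2.i_hom g'(1)] by simp
  have "i_pow a C2 q x (g \<ominus>\<^bsub>Dmod C2 x\<^esub> ?h) = \<zero>\<^bsub>Dmod C2 (x + int q *\<^sub>Z a)\<^esub>"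
    using mod_hom_minus[OF C2.D_group C2.D_group C2.i_pow_hom g(1) h] g'(2) mod_hom_closed[OF C2.i_pow_hom h, of q]
      D'.a_minus_eq_zero_iff by simp
  moreover have "jmap C2 x (g \<ominus>\<^bsub>Dmod C2 x\<^esub> ?h) = fE (x + b) e"
    using mod_hom_minus[OF C2.D_group C2.E_group C2.j_hom g(1) h] C2.j_i_eq_zero[OF g'(1)] g(2)
      mod_hom_closed[OF C2.j_hom g(1)]
    by (simp add: a_minus_def)
  ultimately have "fE (x + b) e \<in> (\<Union>r. Bbdy a b C2 r (x + b))"
    unfolding C2.mem_B_inf_iff using D.minus_closed[OF g(1) h] by metis
  then have "e \<in> (\<Union>r. Bbdy a b C1 r (x + b))" by (rule mem_B_inf_if_mono[OF mono eZ])
  then show ?thesis unfolding C1.mem_B_inf_iff using C1.k_j_eq_zero e(2) by blast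
qed

end


section \<open>The diagrams of constant determinant\<close>

lemma xpos_add: "xpos a b c m (r + k) = xpos a b c m r + k *\<^sub>Z a"
  by (simp add: xpos_def zscale_add_left add.assoc)

lemma Ddiag_simps [simp]:
  "obj (Ddiag a b c C m) r = Dmod C (xpos a b c m r)"
  "arr (Ddiag a b c C m) r = imap C (xpos a b c m r)"
  by (simp_all add: Ddiag_def)

lemma arr_pow_Ddiag: "arr_pow (Ddiag a b c C m) r p = i_pow a C p (xpos a b c m r)"
  by (induction p) (simp_all add: xpos_add)

lemma det2_xpos:
  assumes "sigma a b c \<in> {1, -1}"
  shows "det2 a (xpos a b c m r) = m"
proof -
  have "det2 a (xpos a b c m r) = sigma a b c * m * sigma a b c"
    unfolding sigma_def xpos_def det2_def zscale_def by (simp add: algebra_simps)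
  then show ?thesis using assms by auto
qed

text \<open>As \<open>\<sigma> \<cdot> \<sigma> = 1\<close>, translation by \<open>b + c\<close>, the combined degree of \<open>j\<close> and
  \<open>k\<close>, takes the base points of the line \<open>det = n\<close> to those of the line
  \<open>det = n + \<sigma>\<close> with no shift of the parameter \<open>r\<close>.\<close>

lemma xpos_add_sigma:
  assumes "sigma a b c \<in> {1, -1}"
  shows "xpos a b c (n + sigma a b c) r = xpos a b c n r + b + c"
proof -
  have "sigma a b c * (n + sigma a b c) = sigma a b c * n + 1" using assms by (auto simp: algebra_simps)
  then show ?thesis by (simp add: xpos_def zscale_add_left add.commute add.left_commute)
qed

text \<open>A class of the colimit that is represented in degree \<open>s\<close> is also represented in degree
  \<open>s - 1\<close>, and two representatives agree after enough applications of \<open>i\<close>.\<close>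

lemma (in exact_couple) F_filt_constantD:
  assumes const: "\<forall>r. F_filt a b c C n r = carrier (L_colim a b c C n)"
    and d: "d \<in> carrier (Dmod C (xpos a b c n s))"
  shows "\<exists>d'\<in>carrier (Dmod C (xpos a b c n s - a)). \<exists>q.
    i_pow a C q (xpos a b c n s) d = i_pow a C q (xpos a b c n s) (imap C (xpos a b c n s - a) d')"
proof -
  let ?A = "Ddiag a b c C n"
  have pos: "xpos a b c n (s - 1) = xpos a b c n s - a" using xpos_add[of a b c n "s - 1" 1] by simp
  have "zcolim_in ?A s d \<in> F_filt a b c C n s" using d by (simp add: F_filt_def)
  then have "zcolim_in ?A s d \<in> F_filt a b c C n (s - 1)" using const by simp
  then obtain d' where d': "d' \<in> carrier (Dmod C (xpos a b c n s - a))"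
    "zcolim_in ?A (s - 1) d' = zcolim_in ?A s d"
    unfolding F_filt_def pos by auto
  obtain p q where pq: "s - 1 + int p = s + int q" "arr_pow ?A (s - 1) p d' = arr_pow ?A s q d"
    using zcolim_in_eqD[OF d'(2)] d by auto
  \<comment> \<open>The surplus application of \<open>i\<close>, on the side of \<open>d'\<close>, comes first and brings it to
    degree \<open>s\<close>.\<close>
  then have "p = 1 + q" by linarith
  then have "arr_pow ?A s q d = arr_pow ?A s q (imap C (xpos a b c n s - a) d')"
    using pq(2) arr_pow_add[of ?A "s - 1" 1 q d'] pos by simp
  then show ?thesis using d'(1) unfolding arr_pow_Ddiag by blast
qed

lemma (in couple_morphism) L_lim_map_hom:
  "L_lim_map a b c fD m \<in> mod_hom R (L_lim a b c C1 m) (L_lim a b c C2 m)"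
proof -
  have step: "xpos a b c m (r + 1) = xpos a b c m r + a" for r
    using xpos_add[of a b c m r 1] by simp
  have closed: "fD (xpos a b c m r) d \<in> carrier (Dmod C2 (xpos a b c m r))"
    if "d \<in> carrier (Dmod C1 (xpos a b c m r))" for r d
    using mod_hom_closed[OF fD_hom that] .
  have natural: "imap C2 (xpos a b c m r) (fD (xpos a b c m r) d)
      = fD (xpos a b c m (r + 1)) (imap C1 (xpos a b c m r) d)"
    if "d \<in> carrier (Dmod C1 (xpos a b c m r))" for r d
    using f_i[OF that] by (simp add: step)
  show ?thesis
    unfolding mod_hom_def hom_def L_lim_def L_lim_map_def zlim_def zlim_map_def
    by (auto simp: closed natural mod_hom_add[OF fD_hom] mod_hom_smult[OF fD_hom])
qed

theorem lemma2p5p5: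
  fixes R :: "('r, 'm) ring_scheme"
    and a b c :: "int \<times> int"
    and C1 :: "('r, 'd1, 'e1) couple" and C2 :: "('r, 'd2, 'e2) couple"
    and fD :: "int \<times> int \<Rightarrow> 'd1 \<Rightarrow> 'd2" and fE :: "int \<times> int \<Rightarrow> 'e1 \<Rightarrow> 'e2"
    and n :: int
  assumes "regular_exact_couple R a b c C1"
    and "regular_exact_couple R a b c C2"
    and "couple_morphism R a b c C1 C2 fD fE"
    and "\<forall>r. F_filt a b c C1 n r = carrier (L_colim a b c C1 n)"
    and "\<forall>r. F_filt a b c C2 n r = carrier (L_colim a b c C2 n)"
    and "\<forall>x. det2 a x = n \<longrightarrow>
           mod_mono R (E_inf a b c C1 (x + b)) (E_inf a b c C2 (x + b)) (E_inf_map a b C2 fE (x + b))"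
    and "mod_mono R (L_image a b c C1 (n + sigma a b c)) (L_image a b c C2 (n + sigma a b c))
           (L_colim_map a b c C2 fD (n + sigma a b c))"
  shows "mod_mono R (L_lim a b c C1 (n + sigma a b c)) (L_lim a b c C2 (n + sigma a b c))
           (L_lim_map a b c fD (n + sigma a b c))"
proof -
  interpret couple_morphism R a b c C1 C2 fD fE by (rule assms(3))
  have \<sigma>: "sigma a b c \<in> {1, -1}"
    using assms(1) by (simp add: regular_exact_couple_def regular_exact_couple_axioms_def)
  let ?m = "n + sigma a b c"
  let ?A1 = "Ddiag a b c C1 ?m" and ?A2 = "Ddiag a b c C2 ?m"
  let ?x = "\<lambda>r. xpos a b c n r"
  note pos = xpos_add_sigma[OF \<sigma>, of n]
  have step: "xpos a b c m (r + 1) = xpos a b c m r + a" for m r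
    using xpos_add[of a b c m r 1] by simp
  have "inj_on (L_lim_map a b c fD ?m) (carrier (L_lim a b c C1 ?m))"
  proof (rule inj_onI)
    fix u v
    assume u: "u \<in> carrier (L_lim a b c C1 ?m)" and v: "v \<in> carrier (L_lim a b c C1 ?m)"
      and "L_lim_map a b c fD ?m u = L_lim_map a b c fD ?m v"
    then have f_eq: "fD (xpos a b c ?m r) (u r) = fD (xpos a b c ?m r) (v r)" for r
      by (auto simp: L_lim_map_def zlim_map_def dest: fun_cong)
    note lim = u[unfolded L_lim_def] v[unfolded L_lim_def]
    have lim_closed: "w r \<in> carrier (Dmod C1 (xpos a b c ?m r))"
      and lim_step: "imap C1 (xpos a b c ?m r) (w r) = w (r + 1)"
      and lim_pow: "i_pow a C1 p (xpos a b c ?m r) (w r) = w (r + int p)"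
      if "w \<in> carrier (zlim ?A1)" for w r p
      using that arr_pow_zlim[OF that, of r p] by (simp_all add: zlim_def arr_pow_Ddiag)
    have colim_map: "L_colim_map a b c C2 fD ?m (zlim_to_zcolim ?A1 w)
        = zcolim_in ?A2 0 (fD (xpos a b c ?m 0) (w 0))" if "w \<in> carrier (zlim ?A1)" for w
      unfolding L_colim_map_def zlim_to_zcolim_def
      using mod_hom_closed[OF C1.i_hom] f_i lim_closed[OF that]
      by (intro zcolim_map_zcolim_in) (simp_all add: step)
    have "L_colim_map a b c C2 fD ?m (zlim_to_zcolim ?A1 u)
        = L_colim_map a b c C2 fD ?m (zlim_to_zcolim ?A1 v)"
      using colim_map lim f_eq by simp
    then have "zlim_to_zcolim ?A1 u = zlim_to_zcolim ?A1 v"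
      using assms(7) lim unfolding mod_mono_def L_image_def zcanon_image_def inj_on_def by simp
    then obtain p where p: "u (int p) = v (int p)"
      using zcolim_in_eqD[of ?A1 0 "u 0" 0 "v 0"] lim_closed[OF lim(2), of 0]
        arr_pow_zlim[OF lim(1), of 0] arr_pow_zlim[OF lim(2), of 0]
      by (auto simp: zlim_to_zcolim_def)
    have descend: "u s = v s" if eq: "u (s + 1) = v (s + 1)" for s
    proof -
      let ?y = "?x s + b + c"
      let ?d = "u s \<ominus>\<^bsub>Dmod C1 ?y\<^esub> v s"
      interpret D: abelian_group "Dmod C1 ?y" by (rule C1.D_group)
      have us: "u s \<in> carrier (Dmod C1 ?y)" and vs: "v s \<in> carrier (Dmod C1 ?y)"
        using lim lim_closed[of _ s] by (simp_all add: pos)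
      have "?d = \<zero>\<^bsub>Dmod C1 ?y\<^esub>"
      proof (rule stable_kernel_trivial)
        show "\<exists>d'\<in>carrier (Dmod C2 (?x s - a)). \<exists>q.
            i_pow a C2 q (?x s) d = i_pow a C2 q (?x s) (imap C2 (?x s - a) d')"
          if "d \<in> carrier (Dmod C2 (?x s))" for d
          by (rule C2.F_filt_constantD[OF assms(5) that])
        show "mod_mono R (E_inf a b c C1 (?x s + b)) (E_inf a b c C2 (?x s + b))
            (E_inf_map a b C2 fE (?x s + b))"
          using assms(6) det2_xpos[OF \<sigma>] by blast
        show "?d \<in> carrier (Dmod C1 ?y)" using us vs by simp
        have y: "?x s + a + b + c = ?y + a" by (simp add: algebra_simps)
        have "imap C1 ?y (u s) = imap C1 ?y (v s)"
          using eq lim_step[OF lim(1), of s] lim_step[OF lim(2), of s] by (simp add: pos)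
        then show "imap C1 ?y ?d = \<zero>\<^bsub>Dmod C1 (?x s + a + b + c)\<^esub>"
          unfolding y using mod_hom_minus[OF C1.D_group C1.D_group C1.i_hom us vs]
            abelian_group.a_minus_eq_zero_iff[OF C1.D_group]
            mod_hom_closed[OF C1.i_hom vs] by simp
        show "fD ?y ?d = \<zero>\<^bsub>Dmod C2 ?y\<^esub>"
          using mod_hom_minus[OF C1.D_group C2.D_group fD_hom us vs] f_eq[of s]
            abelian_group.a_minus_eq_zero_iff[OF C2.D_group] mod_hom_closed[OF fD_hom vs]
          by (simp add: pos)
        show "?d \<in> i_pow a C1 r (?y - int r *\<^sub>Z a) ` carrier (Dmod C1 (?y - int r *\<^sub>Z a))" for r
        proof (rule image_eqI)
          let ?z = "?y - int r *\<^sub>Z a"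
          have z: "xpos a b c ?m (s - int r) = ?z"
            using xpos_add[of a b c ?m "s - int r" "int r"] by (simp add: pos)
          have ur: "u (s - int r) \<in> carrier (Dmod C1 ?z)" and vr: "v (s - int r) \<in> carrier (Dmod C1 ?z)"
            using lim lim_closed[of _ "s - int r"] by (simp_all add: z)
          interpret Dz: abelian_group "Dmod C1 ?z" by (rule C1.D_group)
          show "u (s - int r) \<ominus>\<^bsub>Dmod C1 ?z\<^esub> v (s - int r) \<in> carrier (Dmod C1 ?z)" using ur vr by simp
          show "?d = i_pow a C1 r ?z (u (s - int r) \<ominus>\<^bsub>Dmod C1 ?z\<^esub> v (s - int r))"
            using mod_hom_minus[OF C1.D_group C1.D_group C1.i_pow_hom ur vr, of r]
              lim_pow[OF lim(1), of r "s - int r"] lim_pow[OF lim(2), of r "s - int r"] by (simp add: z)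
        qed
      qed
      then show ?thesis using D.a_minus_eq_zero_iff[OF us vs] by simp
    qed
    show "u = v"
    proof
      fix s
      show "u s = v s"
      proof (cases "s \<le> int p")
        case True
        then show ?thesis
          by (induction rule: int_le_induct) (use p descend in auto)
      next
        case False
        then have "int p \<le> s" by simp
        then show ?thesis
          by (induction rule: int_ge_induct) (use p lim_step lim in metis)+
      qed
    qed
  qed
  then show ?thesis unfolding mod_mono_def using L_lim_map_hom by blast
qed

end
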